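(* Let $e_1,e_2,e_3$ be integers with $2\le e_1,e_2,e_3\le 50$, let $v:=e_1e_2e_3$, and let $k$ be an integer with $1<k<v$. Put $d:=\gcd(e_1-1,e_2-1,e_3-1)$, $y_1:=1+\frac{k-1}{v-1}(e_1-1)$, $y_2:=1+\frac{k-1}{v-1}(e_1e_2-1)$. Then the conditions (1) $v-1$ divides $(k-1)d$; (2) $y_1$ is an integer dividing $(e_2-1)e_1/d$; (3) $y_2$ is an integer dividing $(e_3-1)e_1e_2/d$ all hold, and the incidence structure $\mathscr{D}^{\rm ft}((e_1,e_2,e_3);k)$ (defined in the context) is a flag-transitive, $3$-chain-imprimitive $2$-design, if and only if $(e_1,e_2,e_3,k)$ is one of the following $57$ tuples: $(3,5,17,128)$, $(3,5,33,248)$, $(3,5,49,368)$, $(3,9,29,392)$, $(3,13,41,800)$, $(4,4,10,54)$, $(4,4,19,102)$, $(4,4,28,150)$, $(4,4,37,198)$, $(4,4,46,246)$, $(4,7,16,150)$, $(4,7,31,290)$, $(4,7,46,430)$, $(4,10,22,294)$, $(4,10,43,574)$, $(4,13,28,486)$, $(4,16,34,726)$, $(4,19,40,1014)$, $(4,22,46,1350)$, $(5,7,37,648)$, $(5,9,17,192)$, $(5,9,33,372)$, $(5,9,49,552)$, $(6,6,11,80)$, $(6,6,21,152)$, $(6,6,26,375)$, $(6,6,31,224)$, $(6,6,41,296)$, $(6,11,36,476)$, $(6,11,46,1215)$, $(6,16,26,500)$, $(6,26,41,1280)$, $(7,10,37,864)$, $(7,25,37,1080)$, $(8,8,36,330)$,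 $(8,8,50,1372)$, $(8,15,22,378)$, $(8,15,43,738)$, $(8,36,50,2058)$, $(9,5,17,192)$, $(9,5,33,372)$, $(9,5,49,552)$, $(9,9,29,588)$, $(9,13,41,1200)$, $(10,7,37,864)$, $(10,10,28,312)$, $(10,28,37,1152)$, $(11,16,46,1620)$, $(12,12,34,891)$, $(15,8,22,378)$, $(15,8,43,738)$, $(15,8,50,1715)$, $(16,6,26,500)$, $(16,11,46,1620)$, $(25,7,37,1080)$, $(28,10,37,1152)$, $(36,8,50,2058)$.
   Context: Let $\mathscr{P}=\mathbb{Z}_{e_1}\times\mathbb{Z}_{e_2}\times\mathbb{Z}_{e_3}$, with $\mathbb{Z}_{e}=\{0,1,\dots,e-1\}$. For $0\le i\le 3$ let $\mathscr{C}_i$ be the partition of $\mathscr{P}$ in which two points lie in the same class iff their $j$-th coordinates agree for all $j>i$. Let $G=S_{e_1}\wr S_{e_2}\wr S_{e_3}$, the group of all permutations of $\mathscr{P}$ leaving invariant each of $\mathscr{C}_0,\dots,\mathscr{C}_3$. When conditions (1)–(3) hold, set $y_0=1$, $y_3=k$; the ratios $y_i/y_{i-1}$ are then integers with $1<y_i/y_{i-1}<e_i$, and $\mathscr{D}^{\rm ft}((e_1,e_2,e_3);k):=(\mathscr{P},B^G)$, where $B=\{(\delta_1,\delta_2,\delta_3)\in\mathscr{P}: 0\le\delta_i\le \frac{y_i}{y_{i-1}}-1 \text{ for } i=1,2,3\}$ and $B^G=\{B^g: g\in G\}$. A $2$-design is a pair (points, nonempty set of blocks) in which all blocks are point-subsets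 of the same size and any two distinct points lie in the same number of blocks. It is flag-transitive and $3$-chain-imprimitive (here with respect to $G$ and the chain $\mathscr{C}_0,\dots,\mathscr{C}_3$) if $G$ consists of automorphisms, is transitive on the flags (incident point-block pairs), is transitive on points, and leaves each $\mathscr{C}_i$ invariant. *)

theory Defs
  imports Complex_Main "HOL-Combinatorics.Permutations"
begin

type_synonym 'a incidence = "'a set \<times> 'a set set"

text \<open>Finiteness of the point set makes \<^const>\<open>card\<close> the true number of points or blocks below.\<close>

definition is_2_design :: "'a incidence \<Rightarrow> bool" where
  "is_2_design D \<longleftrightarrow>
     (let P = fst D; \<B> = snd D in
        finite P \<and> \<B> \<noteq> {} \<and> (\<forall>B\<in>\<B>. B \<subseteq> P) \<and>
        (\<exists>k. \<forall>B\<in>\<B>. card B = k) \<and>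
        (\<exists>l. \<forall>p\<in>P. \<forall>q\<in>P. p \<noteq> q \<longrightarrow> card {B \<in> \<B>. p \<in> B \<and> q \<in> B} = l))"

definition is_automorphism :: "'a incidence \<Rightarrow> ('a \<Rightarrow> 'a) \<Rightarrow> bool" where
  "is_automorphism D g \<longleftrightarrow> g permutes fst D \<and> (\<lambda>B. g ` B) ` snd D = snd D"

definition flags :: "'a incidence \<Rightarrow> ('a \<times> 'a set) set" where
  "flags D = {(p, B). p \<in> fst D \<and> B \<in> snd D \<and> p \<in> B}"

definition flag_transitive :: "'a incidence \<Rightarrow> ('a \<Rightarrow> 'a) set \<Rightarrow> bool" where
  "flag_transitive D G \<longleftrightarrow>
     (\<forall>(p, B)\<in>flags D. \<forall>(q, C)\<in>flags D. \<exists>g\<in>G. g p = q \<and> g ` B = C)"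

definition point_transitive :: "'a incidence \<Rightarrow> ('a \<Rightarrow> 'a) set \<Rightarrow> bool" where
  "point_transitive D G \<longleftrightarrow> (\<forall>p\<in>fst D. \<forall>q\<in>fst D. \<exists>g\<in>G. g p = q)"

definition leaves_invariant :: "('a \<Rightarrow> 'a) \<Rightarrow> 'a set set \<Rightarrow> bool" where
  "leaves_invariant g \<C> \<longleftrightarrow> (\<lambda>C. g ` C) ` \<C> = \<C>"

definition flag_transitive_chain_imprimitive_2_design ::
    "nat \<Rightarrow> 'a incidence \<Rightarrow> ('a \<Rightarrow> 'a) set \<Rightarrow> (nat \<Rightarrow> 'a set set) \<Rightarrow> bool" where
  "flag_transitive_chain_imprimitive_2_design s D G \<C> \<longleftrightarrow>
     is_2_design D \<and> (\<forall>g\<in>G. is_automorphism D g) \<and>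
     flag_transitive D G \<and> point_transitive D G \<and>
     (\<forall>g\<in>G. \<forall>i\<le>s. leaves_invariant g (\<C> i))"

type_synonym point = "int \<times> int \<times> int"

definition ft_points :: "int \<Rightarrow> int \<Rightarrow> int \<Rightarrow> point set" where
  "ft_points e1 e2 e3 = {0..<e1} \<times> {0..<e2} \<times> {0..<e3}"

text \<open>Coordinates are numbered 1, 2, 3; the value at other indices is irrelevant.\<close>

definition coord :: "nat \<Rightarrow> point \<Rightarrow> int" where
  "coord j = (\<lambda>(a, b, c). if j = 1 then a else if j = 2 then b else c)"

definition ft_chain :: "int \<Rightarrow> int \<Rightarrow> int \<Rightarrow> nat \<Rightarrow> point set set" where
  "ft_chain e1 e2 e3 i =
     ft_points e1 e2 e3 //
       {(p, q). p \<in> ft_points e1 e2 e3 \<and> q \<in> ft_points e1 e2 e3 \<and>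
                (\<forall>j\<in>{i<..3}. coord j p = coord j q)}"

text \<open>The iterated wreath product of three symmetric groups, as the stabiliser of the chain
  in the symmetric group on the points. A permutation of the points is extended by the identity
  outside the point set.\<close>

definition ft_group :: "int \<Rightarrow> int \<Rightarrow> int \<Rightarrow> (point \<Rightarrow> point) set" where
  "ft_group e1 e2 e3 =
     {g. g permutes ft_points e1 e2 e3 \<and> (\<forall>i\<le>3. leaves_invariant g (ft_chain e1 e2 e3 i))}"

definition ft_gcd :: "int \<Rightarrow> int \<Rightarrow> int \<Rightarrow> int" where
  "ft_gcd e1 e2 e3 = gcd (e1 - 1) (gcd (e2 - 1) (e3 - 1))"

text \<open>The numbers $y_0, y_1, y_2, y_3$; they are rational in general.\<close>

definition ft_y :: "int \<Rightarrow> int \<Rightarrow> int \<Rightarrow> int \<Rightarrow> nat \<Rightarrow> rat" where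
  "ft_y e1 e2 e3 k i =
     (if i = 0 then 1
      else if i = 1 then 1 + of_int (k - 1) / of_int (e1 * e2 * e3 - 1) * of_int (e1 - 1)
      else if i = 2 then 1 + of_int (k - 1) / of_int (e1 * e2 * e3 - 1) * of_int (e1 * e2 - 1)
      else of_int k)"

definition ft_base_block :: "int \<Rightarrow> int \<Rightarrow> int \<Rightarrow> int \<Rightarrow> point set" where
  "ft_base_block e1 e2 e3 k =
     {p \<in> ft_points e1 e2 e3. \<forall>i\<in>{1..3}.
        0 \<le> coord i p \<and>
        of_int (coord i p) \<le> ft_y e1 e2 e3 k i / ft_y e1 e2 e3 k (i - 1) - 1}"

definition ft_design :: "int \<Rightarrow> int \<Rightarrow> int \<Rightarrow> int \<Rightarrow> point incidence" where
  "ft_design e1 e2 e3 k =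
     (ft_points e1 e2 e3, {g ` ft_base_block e1 e2 e3 k | g. g \<in> ft_group e1 e2 e3})"

definition ft_cond1 :: "int \<Rightarrow> int \<Rightarrow> int \<Rightarrow> int \<Rightarrow> bool" where
  "ft_cond1 e1 e2 e3 k \<longleftrightarrow> (e1 * e2 * e3 - 1) dvd (k - 1) * ft_gcd e1 e2 e3"

text \<open>The divisions by \<^const>\<open>ft_gcd\<close> are exact, as it divides $e_2 - 1$ and $e_3 - 1$.\<close>

definition ft_cond2 :: "int \<Rightarrow> int \<Rightarrow> int \<Rightarrow> int \<Rightarrow> bool" where
  "ft_cond2 e1 e2 e3 k \<longleftrightarrow>
     (\<exists>m::int. ft_y e1 e2 e3 k 1 = of_int m \<and> m dvd ((e2 - 1) * e1) div ft_gcd e1 e2 e3)"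

definition ft_cond3 :: "int \<Rightarrow> int \<Rightarrow> int \<Rightarrow> int \<Rightarrow> bool" where
  "ft_cond3 e1 e2 e3 k \<longleftrightarrow>
     (\<exists>m::int. ft_y e1 e2 e3 k 2 = of_int m \<and> m dvd ((e3 - 1) * e1 * e2) div ft_gcd e1 e2 e3)"

end

theory Submission
  imports Defs
begin

text \<open>The stabiliser of the chain is transitive on points, and transitive on the ordered pairs of
  points that lie in a common class of the partition number \<open>i\<close> but not of number \<open>i - 1\<close>; the
  permutations needed move coordinates by transpositions that depend on the higher coordinates. For a
  box \<open>B\<close> with sides \<open>x\<^sub>1, x\<^sub>2, x\<^sub>3\<close>, double counting shows that the number of blocks through a pair
  of kind \<open>i\<close> is proportional to \<open>(y\<^sub>i - y\<^sub>i\<^sub>-\<^sub>1) / (E\<^sub>i - E\<^sub>i\<^sub>-\<^sub>1)\<close>, where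
  \<open>y\<^sub>i = x\<^sub>1 \<dots> x\<^sub>i\<close> and \<open>E\<^sub>i = e\<^sub>1 \<dots> e\<^sub>i\<close>. The choice of the \<open>y\<^sub>i\<close> makes this
  ratio independent of \<open>i\<close>, so the conditions (1)--(3) alone imply the design property.

  Writing \<open>e\<^sub>i = 1 + d a\<^sub>i\<close> with \<open>d\<close> the greatest common divisor, condition (1) becomes
  \<open>k - 1 = m (v - 1) / d\<close> with \<open>0 < m < d\<close>, and (2), (3) become divisibilities between polynomials
  in \<open>d, m, a\<^sub>1, a\<^sub>2, a\<^sub>3\<close>, which leaves a small finite search.\<close>

section \<open>Permutation groups and the orbit of a block\<close>

text \<open>This lets membership in the chain stabiliser be tested on pairs of points instead of on
  sets of classes. If \<open>g\<close> permutes the classes, the image of the class of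
  \<open>p\<close> is a class containing \<open>g p\<close>, hence the class of \<open>g p\<close>,
  and injectivity gives both directions of the equivalence. Conversely the class of \<open>p\<close>
  is mapped onto the class of \<open>g p\<close>, and surjectivity of \<open>g\<close> ensures that
  every class is reached.\<close>

lemma leaves_invariant_quotient_iff:
  assumes r: "equiv A r" and g: "bij_betw g A A"
  shows "leaves_invariant g (A // r) \<longleftrightarrow> (\<forall>p\<in>A. \<forall>q\<in>A. (p, q) \<in> r \<longleftrightarrow> (g p, g q) \<in> r)"
proof
  assume inv: "leaves_invariant g (A // r)"
  show "\<forall>p\<in>A. \<forall>q\<in>A. (p, q) \<in> r \<longleftrightarrow> (g p, g q) \<in> r"
  proof (intro ballI)
    fix p q assume pq: "p \<in> A" "q \<in> A"
    have "g ` (r `` {p}) \<in> A // r"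
      using inv pq(1) unfolding leaves_invariant_def by (blast intro: quotientI)
    then obtain x where x: "x \<in> A" "g ` (r `` {p}) = r `` {x}" by (auto elim: quotientE)
    have "g p \<in> g ` (r `` {p})" using pq(1) r by (auto dest: equiv_class_self)
    then have "(x, g p) \<in> r" using x(2) by auto
    then have eq: "g ` (r `` {p}) = r `` {g p}" using x(2) r by (metis equiv_class_eq)
    have sub: "r `` {p} \<subseteq> A" using r by (auto simp: equiv_def refl_on_def)
    have "(p, q) \<in> r \<longleftrightarrow> g q \<in> g ` (r `` {p})"
      using inj_on_image_mem_iff[of g A q "r `` {p}"] g sub pq(2) by (auto simp: bij_betw_def)
    then show "(p, q) \<in> r \<longleftrightarrow> (g p, g q) \<in> r" unfolding eq by simp
  qed
next
  assume *: "\<forall>p\<in>A. \<forall>q\<in>A. (p, q) \<in> r \<longleftrightarrow> (g p, g q) \<in> r"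
  have rA: "\<And>x y. (x, y) \<in> r \<Longrightarrow> x \<in> A \<and> y \<in> A" using r by (auto simp: equiv_def refl_on_def)
  have gA: "g ` A = A" using g by (simp add: bij_betw_def)
  have img: "g ` (r `` {p}) = r `` {g p}" if p: "p \<in> A" for p
  proof (intro equalityI subsetI)
    fix y assume y: "y \<in> r `` {g p}"
    then obtain x where "x \<in> A" "y = g x" using rA gA by blast
    then show "y \<in> g ` (r `` {p})" using y * p by blast
  qed (use * p rA in blast)
  have "(\<lambda>C. g ` C) ` (A // r) = (\<lambda>p. r `` {g p}) ` A"
    unfolding quotient_def UNION_singleton_eq_range image_image by (rule image_cong) (simp_all add: img)
  also have "\<dots> = (\<lambda>x. r `` {x}) ` (g ` A)" by (simp add: image_image)
  also have "\<dots> = A // r" unfolding gA by (auto simp: quotient_def)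
  finally show "leaves_invariant g (A // r)" by (simp add: leaves_invariant_def)
qed

locale permutation_group =
  fixes P :: "'a set" and G :: "('a \<Rightarrow> 'a) set"
  assumes permutes: "g \<in> G \<Longrightarrow> g permutes P"
    and id_mem: "id \<in> G"
    and comp_mem: "g \<in> G \<Longrightarrow> h \<in> G \<Longrightarrow> g \<circ> h \<in> G"
    and inv_mem: "g \<in> G \<Longrightarrow> inv g \<in> G"
begin

definition orbit_blocks :: "'a set \<Rightarrow> 'a set set" where
  "orbit_blocks B = {g ` B | g. g \<in> G}"

lemma base_mem_orbit_blocks: "B \<in> orbit_blocks B"
  unfolding orbit_blocks_def using id_mem by (auto intro!: exI[of _ id])

lemma image_orbit_blocks:
  assumes "g \<in> G"
  shows "(\<lambda>C. g ` C) ` orbit_blocks B = orbit_blocks B"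
proof (intro equalityI subsetI)
  fix C assume "C \<in> (\<lambda>C. g ` C) ` orbit_blocks B"
  then obtain h where "h \<in> G" "C = (g \<circ> h) ` B" unfolding orbit_blocks_def
    by (auto simp: image_comp)
  then show "C \<in> orbit_blocks B" using comp_mem[OF assms] unfolding orbit_blocks_def by blast
next
  fix C assume "C \<in> orbit_blocks B"
  then obtain h where h: "h \<in> G" "C = h ` B" unfolding orbit_blocks_def by auto
  have "g \<circ> (inv g \<circ> h) = h"
    using permutes_inv_o(1)[OF permutes[OF assms]] by (simp add: o_assoc)
  then have "C = g ` ((inv g \<circ> h) ` B)" using h(2) by (metis image_comp)
  moreover have "inv g \<circ> h \<in> G" using comp_mem inv_mem assms h(1) by blast
  ultimately show "C \<in> (\<lambda>C. g ` C) ` orbit_blocks B" unfolding orbit_blocks_def by blast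
qed

lemma orbit_blocks_subset:
  assumes "B \<subseteq> P" "C \<in> orbit_blocks B"
  shows "C \<subseteq> P"
  using assms permutes unfolding orbit_blocks_def by (auto simp: permutes_in_image)

lemma card_orbit_blocks:
  assumes "C \<in> orbit_blocks B"
  shows "card C = card B"
  using assms permutes unfolding orbit_blocks_def
  by (auto intro!: card_image intro: inj_on_subset[OF permutes_inj])

lemma is_automorphism_orbit_blocks:
  assumes "g \<in> G"
  shows "is_automorphism (P, orbit_blocks B) g"
  using assms permutes image_orbit_blocks by (simp add: is_automorphism_def)

text \<open>Every flag is a translate of a flag on the base block, so transitivity of the stabiliser
  of \<open>B\<close> on the points of \<open>B\<close> suffices: go back to \<open>B\<close>, move
  within \<open>B\<close>, and go out to the other block.\<close>

lemma flag_transitive_orbit_blocks: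
  assumes stab: "\<And>p q. p \<in> B \<Longrightarrow> q \<in> B \<Longrightarrow> \<exists>s\<in>G. s p = q \<and> s ` B = B"
  shows "flag_transitive (P, orbit_blocks B) G"
  unfolding flag_transitive_def
proof clarify
  fix p C q D assume "(p, C) \<in> flags (P, orbit_blocks B)" "(q, D) \<in> flags (P, orbit_blocks B)"
  then obtain g h x y where gh: "g \<in> G" "h \<in> G" "x \<in> B" "y \<in> B"
    and eq: "C = g ` B" "D = h ` B" "p = g x" "q = h y"
    unfolding flags_def orbit_blocks_def by auto
  obtain s where s: "s \<in> G" "s x = y" "s ` B = B" using stab gh by blast
  have inv: "\<And>z. inv g (g z) = z" using permutes_inverses[OF permutes[OF gh(1)]] by simp
  have "h \<circ> s \<circ> inv g \<in> G" using comp_mem inv_mem gh s by blast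
  moreover have "(h \<circ> s \<circ> inv g) p = q" using eq s inv by simp
  moreover have "(h \<circ> s \<circ> inv g) ` C = D"
  proof -
    have "(h \<circ> s \<circ> inv g) ` C = h ` (s ` B)" unfolding eq by (simp add: image_image inv)
    then show ?thesis using s eq by simp
  qed
  ultimately show "\<exists>g\<in>G. g p = q \<and> g ` C = D" by blast
qed

text \<open>Count the incidences between pairs in \<open>R\<close> and blocks containing both points
  of the pair. The number of blocks is the same for each pair because \<open>G\<close> is transitive
  on \<open>R\<close>; the number of pairs is the same for each block because the blocks are
  translates of \<open>B\<close> and \<open>R\<close> is invariant.\<close>

lemma card_blocks_through_pair:
  assumes fin: "finite P" and BP: "B \<subseteq> P" and RP: "R \<subseteq> P \<times> P"
    and inv: "\<And>g p q. g \<in> G \<Longrightarrow> p \<in> P \<Longrightarrow> q \<in> P \<Longrightarrow> (p, q) \<in> R \<longleftrightarrow> (g p, g q) \<in> R"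
    and trans: "\<And>p q p' q'. (p, q) \<in> R \<Longrightarrow> (p', q') \<in> R \<Longrightarrow> \<exists>g\<in>G. g p = p' \<and> g q = q'"
    and pq: "(p, q) \<in> R"
  shows "card {C \<in> orbit_blocks B. p \<in> C \<and> q \<in> C} * card R =
         card (orbit_blocks B) * card (R \<inter> B \<times> B)"
proof -
  let ?n = "\<lambda>z. card {C \<in> orbit_blocks B. fst z \<in> C \<and> snd z \<in> C}"
  have finR: "finite R" using RP fin by (meson finite_SigmaI finite_subset)
  have "orbit_blocks B \<subseteq> Pow P" using orbit_blocks_subset[OF BP] by blast
  then have finB: "finite (orbit_blocks B)" using fin by (meson finite_Pow_iff finite_subset)
  have const: "?n z = ?n (p, q)" if zR: "z \<in> R" for z
  proof -
    obtain g where g: "g \<in> G" "g p = fst z" "g q = snd z" using trans[OF pq, of "fst z" "snd z"] zR by auto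
    have injg: "inj g" using permutes[OF g(1)] by (rule permutes_inj)
    have "{C \<in> orbit_blocks B. fst z \<in> C \<and> snd z \<in> C} =
          (\<lambda>C. g ` C) ` {C \<in> orbit_blocks B. p \<in> C \<and> q \<in> C}"
      (is "?L = ?R")
    proof (intro equalityI subsetI)
      fix D assume D: "D \<in> ?L"
      then have "D \<in> (\<lambda>C. g ` C) ` orbit_blocks B" using image_orbit_blocks[OF g(1)] by blast
      then obtain C where C: "C \<in> orbit_blocks B" "D = g ` C" by blast
      then have "p \<in> C" "q \<in> C" using D g(2,3)[symmetric] injg by (simp_all add: inj_image_mem_iff)
      then show "D \<in> ?R" using C by blast
    next
      fix D assume "D \<in> ?R"
      then obtain C where C: "C \<in> orbit_blocks B" "p \<in> C" "q \<in> C" "D = g ` C" by blast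
      then have "D \<in> orbit_blocks B" using image_orbit_blocks[OF g(1), of B] by blast
      then show "D \<in> ?L" using C g by (metis (mono_tags, lifting) imageI mem_Collect_eq)
    qed
    moreover have "inj_on (\<lambda>C. g ` C) X" for X using injg by (simp add: inj_on_def inj_image_eq_iff)
    ultimately show ?thesis by (simp add: card_image)
  qed
  have block: "card {z \<in> R. fst z \<in> C \<and> snd z \<in> C} = card (R \<inter> B \<times> B)"
    if C: "C \<in> orbit_blocks B" for C
  proof -
    obtain g where g: "g \<in> G" "C = g ` B" using C unfolding orbit_blocks_def by auto
    have injg: "inj g" using permutes[OF g(1)] by (rule permutes_inj)
    have "{z \<in> R. fst z \<in> C \<and> snd z \<in> C} = map_prod g g ` (R \<inter> B \<times> B)"
      using g inv[OF g(1)] BP by (force simp: image_iff)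
    moreover have "inj_on (map_prod g g) X" for X
      using injg by (auto simp: inj_on_def inj_def)
    ultimately show ?thesis by (simp add: card_image)
  qed
  have "(\<Sum>z\<in>R. ?n z) = (\<Sum>C\<in>orbit_blocks B. card (R \<inter> B \<times> B))"
    by (rule sum_multicount_gen[OF finR finB]) (use block in blast)
  then have "(\<Sum>z\<in>R. ?n (p, q)) = (\<Sum>C\<in>orbit_blocks B. card (R \<inter> B \<times> B))"
    using const by simp
  then show ?thesis by (simp add: mult.commute)
qed

end

section \<open>The chain stabiliser and its transitivity properties\<close>

text \<open>The equivalence relation behind \<open>ft_chain\<close>. On points it is equality for
  \<open>i = 0\<close> and the full relation for \<open>i = 3\<close>, so the differences of
  consecutive relations split the pairs of distinct points into three kinds.\<close>

definition ft_rel :: "int \<Rightarrow> int \<Rightarrow> int \<Rightarrow> nat \<Rightarrow> (point \<times> point) set" where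
  "ft_rel e1 e2 e3 i =
     {(p, q). p \<in> ft_points e1 e2 e3 \<and> q \<in> ft_points e1 e2 e3 \<and>
              (\<forall>j\<in>{i<..3}. coord j p = coord j q)}"

lemma ft_chain_eq: "ft_chain e1 e2 e3 i = ft_points e1 e2 e3 // ft_rel e1 e2 e3 i"
  by (simp add: ft_chain_def ft_rel_def)

lemma equiv_ft_rel: "equiv (ft_points e1 e2 e3) (ft_rel e1 e2 e3 i)"
  by (auto simp: ft_rel_def intro!: equivI refl_onI symI transI)

lemma finite_ft_points: "finite (ft_points e1 e2 e3)"
  by (simp add: ft_points_def)

lemma coord_simps [simp]:
  "coord (Suc 0) (a, b, c) = a" "coord 2 (a, b, c) = b" "coord 3 (a, b, c) = c"
  by (simp_all add: coord_def)

lemma mem_ft_rel_iff: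
  "((a, b, c), (a', b', c')) \<in> ft_rel e1 e2 e3 i \<longleftrightarrow>
     (a, b, c) \<in> ft_points e1 e2 e3 \<and> (a', b', c') \<in> ft_points e1 e2 e3 \<and>
     (i < 1 \<longrightarrow> a = a') \<and> (i < 2 \<longrightarrow> b = b') \<and> (i < 3 \<longrightarrow> c = c')"
proof -
  have "{i<..3} = {j \<in> {1, 2, 3}. i < j}" by auto
  then have "(\<forall>j\<in>{i<..3}. Q j) \<longleftrightarrow> (i < 1 \<longrightarrow> Q 1) \<and> (i < 2 \<longrightarrow> Q 2) \<and> (i < 3 \<longrightarrow> Q 3)" for Q
    by (metis (no_types, lifting) insertE insertI1 insertI2 mem_Collect_eq singletonD)
  then show ?thesis by (simp add: ft_rel_def)
qed

lemma mem_ft_group_iff: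
  "g \<in> ft_group e1 e2 e3 \<longleftrightarrow> g permutes ft_points e1 e2 e3 \<and>
     (\<forall>i\<le>3. \<forall>p\<in>ft_points e1 e2 e3. \<forall>q\<in>ft_points e1 e2 e3.
        (p, q) \<in> ft_rel e1 e2 e3 i \<longleftrightarrow> (g p, g q) \<in> ft_rel e1 e2 e3 i)"
  unfolding ft_group_def ft_chain_eq
  using leaves_invariant_quotient_iff[OF equiv_ft_rel permutes_imp_bij] by blast

lemma ft_group_ft_rel_iff:
  assumes "g \<in> ft_group e1 e2 e3" "i \<le> 3" "p \<in> ft_points e1 e2 e3" "q \<in> ft_points e1 e2 e3"
  shows "(g p, g q) \<in> ft_rel e1 e2 e3 i \<longleftrightarrow> (p, q) \<in> ft_rel e1 e2 e3 i"
  using assms by (simp add: mem_ft_group_iff)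

lemma ft_group_permutation_group: "permutation_group (ft_points e1 e2 e3) (ft_group e1 e2 e3)"
proof
  fix g h assume g: "g \<in> ft_group e1 e2 e3"
  then show perm: "g permutes ft_points e1 e2 e3" by (simp add: mem_ft_group_iff)
  show "inv g \<in> ft_group e1 e2 e3"
    unfolding mem_ft_group_iff
  proof (intro conjI allI impI ballI)
    show "inv g permutes ft_points e1 e2 e3" using perm by (rule permutes_inv)
    fix i :: nat and p q
    assume "i \<le> 3" "p \<in> ft_points e1 e2 e3" "q \<in> ft_points e1 e2 e3"
    moreover have "g (inv g p) = p" "g (inv g q) = q" using permutes_inverses[OF perm] by auto
    ultimately show "(p, q) \<in> ft_rel e1 e2 e3 i \<longleftrightarrow> (inv g p, inv g q) \<in> ft_rel e1 e2 e3 i"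
      using g permutes_in_image[OF permutes_inv[OF perm]] unfolding mem_ft_group_iff by metis
  qed
  assume "h \<in> ft_group e1 e2 e3"
  then show "g \<circ> h \<in> ft_group e1 e2 e3"
    unfolding mem_ft_group_iff
  proof (elim conjE, intro conjI allI impI ballI)
    assume h: "h permutes ft_points e1 e2 e3"
      "\<forall>i\<le>3. \<forall>p\<in>ft_points e1 e2 e3. \<forall>q\<in>ft_points e1 e2 e3.
        (p, q) \<in> ft_rel e1 e2 e3 i \<longleftrightarrow> (h p, h q) \<in> ft_rel e1 e2 e3 i"
    show "g \<circ> h permutes ft_points e1 e2 e3" using h(1) perm by (rule permutes_compose)
    fix i :: nat and p q
    assume "i \<le> 3" "p \<in> ft_points e1 e2 e3" "q \<in> ft_points e1 e2 e3"
    then show "(p, q) \<in> ft_rel e1 e2 e3 i \<longleftrightarrow> ((g \<circ> h) p, (g \<circ> h) q) \<in> ft_rel e1 e2 e3 i"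
      using g h(2) permutes_in_image[OF h(1)] unfolding mem_ft_group_iff comp_apply by metis
  qed
next
  show "id \<in> ft_group e1 e2 e3" using permutes_id by (auto simp: mem_ft_group_iff)
qed

text \<open>The imprimitive action of an element of the iterated wreath product. The permutations of
  the lower coordinates are selected by the old values of the higher coordinates; the identity
  outside the point set is what \<open>permutes\<close> demands.\<close>

definition wreath_perm ::
    "int \<Rightarrow> int \<Rightarrow> int \<Rightarrow> (int \<Rightarrow> int \<Rightarrow> int \<Rightarrow> int) \<Rightarrow> (int \<Rightarrow> int \<Rightarrow> int) \<Rightarrow> (int \<Rightarrow> int) \<Rightarrow> point \<Rightarrow> point"
  where
  "wreath_perm e1 e2 e3 \<sigma> \<tau> \<rho> = (\<lambda>(a, b, c).
     if (a, b, c) \<in> ft_points e1 e2 e3 then (\<sigma> b c a, \<tau> c b, \<rho> c) else (a, b, c))"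

text \<open>The image coordinates above \<open>i\<close> depend only on the coordinates above
  \<open>i\<close>, and injectively, so each relation is preserved and reflected. Injectivity of the
  map is the case \<open>i = 0\<close>, where the relation is equality; surjectivity then follows
  from finiteness.\<close>

lemma wreath_perm_mem:
  assumes "\<And>b c. \<sigma> b c permutes {0..<e1}" and "\<And>c. \<tau> c permutes {0..<e2}"
    and "\<rho> permutes {0..<e3}"
  shows "wreath_perm e1 e2 e3 \<sigma> \<tau> \<rho> \<in> ft_group e1 e2 e3"
proof -
  let ?P = "ft_points e1 e2 e3" and ?g = "wreath_perm e1 e2 e3 \<sigma> \<tau> \<rho>"
  have inj: "\<sigma> b c x = \<sigma> b c y \<longleftrightarrow> x = y" "\<tau> c x = \<tau> c y \<longleftrightarrow> x = y" "\<rho> x = \<rho> y \<longleftrightarrow> x = y"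
    for b c x y
    using assms by (blast dest: permutes_inj injD)+
  have into: "?g p \<in> ?P" if "p \<in> ?P" for p
    using that permutes_in_image[OF assms(1)] permutes_in_image[OF assms(2)]
      permutes_in_image[OF assms(3)]
    by (auto simp: wreath_perm_def ft_points_def split: prod.splits)
  have rel: "(p, q) \<in> ft_rel e1 e2 e3 i \<longleftrightarrow> (?g p, ?g q) \<in> ft_rel e1 e2 e3 i"
    if p: "p \<in> ?P" and q: "q \<in> ?P" for p q i
  proof -
    obtain a b c a' b' c' where [simp]: "p = (a, b, c)" "q = (a', b', c')" by (cases p, cases q) auto
    have *: "?g p = (\<sigma> b c a, \<tau> c b, \<rho> c)" "?g q = (\<sigma> b' c' a', \<tau> c' b', \<rho> c')"
      using p q by (simp_all add: wreath_perm_def)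
    show ?thesis
      using p q into[OF p] into[OF q] unfolding * by (auto simp: mem_ft_rel_iff inj)
  qed
  have "inj_on ?g ?P"
  proof (rule inj_onI)
    fix p q assume pq: "p \<in> ?P" "q \<in> ?P" "?g p = ?g q"
    then have "(?g p, ?g q) \<in> ft_rel e1 e2 e3 0"
      using into equiv_ft_rel by (simp add: equiv_def refl_on_def)
    then have "(p, q) \<in> ft_rel e1 e2 e3 0" using rel pq by blast
    then show "p = q" by (cases p, cases q) (simp add: mem_ft_rel_iff)
  qed
  moreover have "?g ` ?P \<subseteq> ?P" using into by blast
  ultimately have "bij_betw ?g ?P ?P"
    by (simp add: bij_betw_def endo_inj_surj finite_ft_points)
  then have "?g permutes ?P"
    by (rule bij_imp_permutes) (auto simp: wreath_perm_def)
  then show ?thesis using rel by (simp add: mem_ft_group_iff)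
qed

text \<open>One transposition in each coordinate, with both entries inside the side of the box,
  preserves the box. For a base block this gives flag-transitivity; for the box of all points it
  gives point-transitivity.\<close>

lemma ft_group_move_point:
  assumes "B = {0..<x1} \<times> {0..<x2} \<times> {0..<x3}" "x1 \<le> e1" "x2 \<le> e2" "x3 \<le> e3"
    and "p \<in> B" "q \<in> B"
  shows "\<exists>s\<in>ft_group e1 e2 e3. s p = q \<and> s ` B = B"
proof -
  obtain a b c a' b' c' where pq [simp]: "p = (a, b, c)" "q = (a', b', c')" by (cases p, cases q) auto
  let ?s = "wreath_perm e1 e2 e3 (\<lambda>_ _. transpose a a') (\<lambda>_. transpose b b') (transpose c c')"
  have s: "?s \<in> ft_group e1 e2 e3"
    by (rule wreath_perm_mem; rule permutes_swap_id) (use assms in auto)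
  have BP: "B \<subseteq> ft_points e1 e2 e3" using assms by (auto simp: ft_points_def)
  have maps: "transpose u w y \<in> {0..<x}" if "u \<in> {0..<x}" "w \<in> {0..<x}" "y \<in> {0..<x}"
    for u w y x :: int
    using that by (simp add: transpose_def)
  have "?s ` B \<subseteq> B"
  proof (rule image_subsetI)
    fix r assume "r \<in> B"
    then obtain x y z where r [simp]: "r = (x, y, z)" and xyz: "(x, y, z) \<in> B" by (cases r) auto
    then have "?s (x, y, z) = (transpose a a' x, transpose b b' y, transpose c c' z)"
      using BP by (auto simp: wreath_perm_def)
    then show "?s r \<in> B" using maps xyz assms(1,5,6) unfolding pq r by auto
  qed
  moreover have "inj_on ?s B"
    using s by (auto simp: mem_ft_group_iff intro: inj_on_subset[OF permutes_inj])
  moreover have "finite B" using assms by simp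
  ultimately have "?s ` B = B" by (simp add: endo_inj_surj)
  moreover have "?s p = q" using assms by (auto simp: wreath_perm_def ft_points_def)
  ultimately show ?thesis using s by blast
qed

lemma ft_group_transitive:
  assumes "p \<in> ft_points e1 e2 e3" "q \<in> ft_points e1 e2 e3"
  shows "\<exists>g\<in>ft_group e1 e2 e3. g p = q"
  using ft_group_move_point[OF refl order_refl order_refl order_refl, of p e1 e2 e3 q] assms
  unfolding ft_points_def by blast

text \<open>In coordinate \<open>i\<close> both \<open>q\<close> and \<open>q'\<close> differ from
  \<open>p\<close>, so exchanging their entries there leaves the entry of \<open>p\<close> alone.
  Above \<open>i\<close> all three points agree and the transpositions are trivial. Below
  \<open>i\<close> the points \<open>q\<close> and \<open>q'\<close> lie in other fibres than
  \<open>p\<close>, so their entries can be adjusted without touching the fibre of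
  \<open>p\<close>.\<close>

lemma ft_group_fix_move:
  assumes i: "1 \<le> i" "i \<le> 3"
    and q: "(p, q) \<in> ft_rel e1 e2 e3 i - ft_rel e1 e2 e3 (i - 1)"
    and q': "(p, q') \<in> ft_rel e1 e2 e3 i - ft_rel e1 e2 e3 (i - 1)"
  shows "\<exists>g\<in>ft_group e1 e2 e3. g p = p \<and> g q = q'"
proof -
  obtain a b c where p [simp]: "p = (a, b, c)" by (cases p) auto
  obtain x y z x' y' z' where qq [simp]: "q = (x, y, z)" "q' = (x', y', z')" by (cases q, cases q') auto
  have mem: "(a, b, c) \<in> ft_points e1 e2 e3" "(x, y, z) \<in> ft_points e1 e2 e3"
    "(x', y', z') \<in> ft_points e1 e2 e3"
    using q q' by (auto simp: mem_ft_rel_iff)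
  \<comment> \<open>Transpositions take \<open>q\<close> to \<open>q'\<close>; they are suppressed where they could move \<open>p\<close>.\<close>
  define \<sigma> where "\<sigma> = (\<lambda>v w. if i \<ge> 2 \<and> v = b \<and> w = c then id else transpose x x')"
  define \<tau> where "\<tau> = (\<lambda>w. if i \<ge> 3 \<and> w = c then id else transpose y y')"
  let ?g = "wreath_perm e1 e2 e3 \<sigma> \<tau> (transpose z z')"
  have "\<sigma> v w permutes {0..<e1}" "\<tau> w permutes {0..<e2}" "transpose z z' permutes {0..<e3}" for v w
    using mem by (auto simp: \<sigma>_def \<tau>_def ft_points_def permutes_id permutes_swap_id)
  then have "?g \<in> ft_group e1 e2 e3" by (rule wreath_perm_mem)
  moreover consider "i = 1" | "i = 2" | "i = 3" using i by linarith
  then have "?g p = p \<and> ?g q = q'"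
  proof cases
    case 1
    then have "x \<noteq> a" "x' \<noteq> a" "y = b" "y' = b" "z = c" "z' = c"
      using q q' by (auto simp: mem_ft_rel_iff)
    then show ?thesis using mem 1 by (simp add: wreath_perm_def \<sigma>_def \<tau>_def)
  next
    case 2
    then have "y \<noteq> b" "y' \<noteq> b" "z = c" "z' = c"
      using q q' by (auto simp: mem_ft_rel_iff)
    then show ?thesis using mem 2 by (simp add: wreath_perm_def \<sigma>_def \<tau>_def)
  next
    case 3
    then have "z \<noteq> c" "z' \<noteq> c"
      using q q' by (auto simp: mem_ft_rel_iff)
    then show ?thesis using mem 3 by (simp add: wreath_perm_def \<sigma>_def \<tau>_def)
  qed
  ultimately show ?thesis by blast
qed

text \<open>First send \<open>p\<close> to \<open>p'\<close>; the image of \<open>q\<close> is then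
  in the same kind of relation to \<open>p'\<close> as \<open>q'\<close> is, and the stabiliser of
  \<open>p'\<close> finishes the job.\<close>

lemma ft_group_move_pair:
  assumes i: "1 \<le> i" "i \<le> 3"
    and pq: "(p, q) \<in> ft_rel e1 e2 e3 i - ft_rel e1 e2 e3 (i - 1)"
    and pq': "(p', q') \<in> ft_rel e1 e2 e3 i - ft_rel e1 e2 e3 (i - 1)"
  shows "\<exists>g\<in>ft_group e1 e2 e3. g p = p' \<and> g q = q'"
proof -
  interpret permutation_group "ft_points e1 e2 e3" "ft_group e1 e2 e3"
    by (rule ft_group_permutation_group)
  have mem: "p \<in> ft_points e1 e2 e3" "q \<in> ft_points e1 e2 e3" "p' \<in> ft_points e1 e2 e3"
    using pq pq' by (auto simp: ft_rel_def)
  then obtain g where g: "g \<in> ft_group e1 e2 e3" "g p = p'" using ft_group_transitive by blast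
  have "(p', g q) \<in> ft_rel e1 e2 e3 i - ft_rel e1 e2 e3 (i - 1)"
    using pq i mem unfolding g(2)[symmetric] by (simp add: ft_group_ft_rel_iff[OF g(1)])
  then obtain h where "h \<in> ft_group e1 e2 e3" "h p' = p'" "h (g q) = q'"
    using ft_group_fix_move[OF i _ pq'] by blast
  then show ?thesis using g comp_mem by (metis comp_apply)
qed

section \<open>Counting pairs, and the design property for orbits of boxes\<close>

text \<open>Given the first point of a pair, the coordinates of the second are free in the box up to
  index \<open>i\<close> and forced above it. Taking the box of all points as \<open>B\<close>
  counts the whole relation.\<close>

lemma card_ft_rel_box:
  assumes "0 \<le> x1" "x1 \<le> e1" "0 \<le> x2" "x2 \<le> e2" "0 \<le> x3" "x3 \<le> e3"
    and "B = {0..<x1} \<times> {0..<x2} \<times> {0..<x3}"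
  shows "int (card (ft_rel e1 e2 e3 i \<inter> B \<times> B)) =
    x1 * x2 * x3 * ((if 1 \<le> i then x1 else 1) * (if 2 \<le> i then x2 else 1) * (if 3 \<le> i then x3 else 1))"
proof -
  define I where "I = (\<lambda>n x y. if n \<le> i then {0..<x} else {y :: int})"
  have "ft_rel e1 e2 e3 i \<inter> B \<times> B = Sigma B (\<lambda>(a, b, c). I 1 x1 a \<times> I 2 x2 b \<times> I 3 x3 c)"
    using assms by (auto simp: mem_ft_rel_iff ft_points_def I_def split: if_splits)
  moreover have "int (card (I n x y)) = (if n \<le> i then x else 1)" if "0 \<le> x" for n x y
    using that by (simp add: I_def)
  moreover have "finite (I n x y)" for n x y by (simp add: I_def)
  ultimately show ?thesis
    using assms by (simp add: card_SigmaI card_cartesian_product case_prod_unfold)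
qed

lemma ft_rel_mono: "i \<le> j \<Longrightarrow> ft_rel e1 e2 e3 i \<subseteq> ft_rel e1 e2 e3 j"
  by (auto simp: ft_rel_def)

lemma ft_rel_subset: "ft_rel e1 e2 e3 i \<subseteq> ft_points e1 e2 e3 \<times> ft_points e1 e2 e3"
  by (auto simp: ft_rel_def)

text \<open>The index \<open>i\<close> is the largest one at which the two points have different
  coordinates.\<close>

lemma distinct_points_ft_rel:
  assumes "p \<in> ft_points e1 e2 e3" "q \<in> ft_points e1 e2 e3" "p \<noteq> q"
  obtains i where "1 \<le> i" "i \<le> 3" "(p, q) \<in> ft_rel e1 e2 e3 i - ft_rel e1 e2 e3 (i - 1)"
proof -
  obtain a b c a' b' c' where pq [simp]: "p = (a, b, c)" "q = (a', b', c')" by (cases p, cases q) auto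
  consider "c \<noteq> c'" | "c = c'" "b \<noteq> b'" | "c = c'" "b = b'" "a \<noteq> a'" using assms(3) by auto
  then show ?thesis
  proof cases
    case 1 then show ?thesis using assms that[of 3] by (simp add: mem_ft_rel_iff)
  next
    case 2 then show ?thesis using assms that[of 2] by (simp add: mem_ft_rel_iff)
  next
    case 3 then show ?thesis using assms that[of 1] by (simp add: mem_ft_rel_iff)
  qed
qed

text \<open>The assumptions \<open>ratio\<close> say that \<open>Y i - 1\<close> and
  \<open>E i - 1\<close> are in the same proportion for \<open>i = 1, 2\<close> as for
  \<open>i = 3\<close>. Consecutive differences inherit this proportion, so the pair count comes out
  the same for all three kinds of pairs.\<close>

lemma box_orbit_2_design:
  assumes e: "2 \<le> e1" "2 \<le> e2" "2 \<le> e3"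
    and x: "1 \<le> x1" "x1 \<le> e1" "1 \<le> x2" "x2 \<le> e2" "1 \<le> x3" "x3 \<le> e3"
    and ratio: "(e1 * e2 * e3 - 1) * (x1 - 1) = (x1 * x2 * x3 - 1) * (e1 - 1)"
      "(e1 * e2 * e3 - 1) * (x1 * x2 - 1) = (x1 * x2 * x3 - 1) * (e1 * e2 - 1)"
    and B: "B = {0..<x1} \<times> {0..<x2} \<times> {0..<x3}"
  shows "flag_transitive_chain_imprimitive_2_design 3
    (ft_points e1 e2 e3, {g ` B | g. g \<in> ft_group e1 e2 e3}) (ft_group e1 e2 e3) (ft_chain e1 e2 e3)"
proof -
  let ?P = "ft_points e1 e2 e3" and ?G = "ft_group e1 e2 e3" and ?r = "ft_rel e1 e2 e3"
  interpret permutation_group ?P ?G by (rule ft_group_permutation_group)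
  let ?\<B> = "orbit_blocks B"
  define v k where "v = e1 * e2 * e3" and "k = x1 * x2 * x3"
  define E where "E = (\<lambda>i::nat. (if 1 \<le> i then e1 else 1) * (if 2 \<le> i then e2 else 1) * (if 3 \<le> i then e3 else 1))"
  define Y where "Y = (\<lambda>i::nat. (if 1 \<le> i then x1 else 1) * (if 2 \<le> i then x2 else 1) * (if 3 \<le> i then x3 else 1))"
  have "2 * 2 \<le> e1 * e2" using e by (intro mult_mono) auto
  then have "2 * 2 * 2 \<le> e1 * e2 * e3" using e by (intro mult_mono) auto
  then have v: "v > 1" by (simp add: v_def)
  have BP: "B \<subseteq> ?P" using x B by (auto simp: ft_points_def)
  have cardB: "int (card (?r i \<inter> B \<times> B)) = k * Y i" for i
    using card_ft_rel_box[of x1 e1 x2 e2 x3 e3 B i] x B by (simp add: k_def Y_def)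
  have "?r i \<inter> ?P \<times> ?P = ?r i" for i using ft_rel_subset by blast
  then have cardP: "int (card (?r i)) = v * E i" for i
    using card_ft_rel_box[of e1 e1 e2 e2 e3 e3 ?P i] e by (simp add: v_def E_def ft_points_def)
  \<comment> \<open>For \<open>i = 0\<close> both sides vanish, and from \<open>3\<close> on the two
    sides are equal up to the order of the factors; the remaining cases are
    \<open>ratio\<close>.\<close>
  have EY: "(v - 1) * (Y i - 1) = (k - 1) * (E i - 1)" for i
  proof -
    consider "i = 0" | "i = 1" | "i = 2" | "3 \<le> i" by linarith
    then show ?thesis using ratio unfolding v_def k_def by cases (simp_all add: E_def Y_def)
  qed
  have fin_r: "finite (?r i)" for i
    using ft_rel_subset finite_ft_points by (meson finite_SigmaI finite_subset)
  have card_diff: "int (card (S - T)) = int (card S) - int (card T)"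
    if "finite S" "T \<subseteq> S" for S T :: "(point \<times> point) set"
    using that by (simp add: card_Diff_subset card_mono finite_subset of_nat_diff)
  \<comment> \<open>The standard identity between the parameters of a 2-design, but with a count
    that may still depend on the pair; its right-hand side shows that it does not.\<close>
  have count: "int (card {C \<in> ?\<B>. p \<in> C \<and> q \<in> C}) * (v * (v - 1)) = int (card ?\<B>) * (k * (k - 1))"
    if pq: "p \<in> ?P" "q \<in> ?P" "p \<noteq> q" for p q
  proof -
    obtain i where i: "1 \<le> i" "i \<le> 3" and R: "(p, q) \<in> ?r i - ?r (i - 1)"
      using distinct_points_ft_rel[OF pq] .
    let ?R = "?r i - ?r (i - 1)"
    let ?n = "int (card {C \<in> ?\<B>. p \<in> C \<and> q \<in> C})"
    have "card {C \<in> ?\<B>. p \<in> C \<and> q \<in> C} * card ?R = card ?\<B> * card (?R \<inter> B \<times> B)"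
    proof (rule card_blocks_through_pair[OF finite_ft_points BP _ _ _ R])
      show "?R \<subseteq> ?P \<times> ?P" using ft_rel_subset by blast
      show "(s, t) \<in> ?R \<longleftrightarrow> (g s, g t) \<in> ?R" if "g \<in> ?G" "s \<in> ?P" "t \<in> ?P" for g s t
        using i that by (simp add: ft_group_ft_rel_iff)
      show "\<exists>g\<in>?G. g s = s' \<and> g t = t'" if "(s, t) \<in> ?R" "(s', t') \<in> ?R" for s t s' t'
        using i that by (rule ft_group_move_pair)
    qed
    then have "?n * int (card ?R) = int (card ?\<B>) * int (card (?R \<inter> B \<times> B))"
      by (simp flip: of_nat_mult)
    moreover have "int (card ?R) = v * (E i - E (i - 1))"
      unfolding card_diff[OF fin_r ft_rel_mono[OF diff_le_self]] cardP
      by (rule right_diff_distrib[symmetric])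
    moreover have "?R \<inter> B \<times> B = (?r i \<inter> B \<times> B) - (?r (i - 1) \<inter> B \<times> B)" by blast
    moreover have "int (card ((?r i \<inter> B \<times> B) - (?r (i - 1) \<inter> B \<times> B))) = k * (Y i - Y (i - 1))"
      unfolding card_diff[OF finite_Int[OF disjI1[OF fin_r]] Int_mono[OF ft_rel_mono[OF diff_le_self] order_refl]] cardB
      by (rule right_diff_distrib[symmetric])
    ultimately have "?n * (v * (E i - E (i - 1))) = int (card ?\<B>) * (k * (Y i - Y (i - 1)))"
      by simp
    \<comment> \<open>The factor \<open>v - 1\<close> allows \<open>EY\<close> to replace the
      differences of \<open>Y\<close> by differences of \<open>E\<close>, which can then be
      cancelled.\<close>
    then have "?n * (v * (E i - E (i - 1))) * (v - 1) =
        int (card ?\<B>) * (k * (Y i - Y (i - 1))) * (v - 1)"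
      by simp
    also have "\<dots> = int (card ?\<B>) * k * ((v - 1) * (Y i - 1) - (v - 1) * (Y (i - 1) - 1))"
      by (simp add: algebra_simps)
    also have "\<dots> = int (card ?\<B>) * (k * (k - 1)) * (E i - E (i - 1))"
      unfolding EY by (simp add: algebra_simps)
    finally have "(?n * (v * (v - 1))) * (E i - E (i - 1)) =
        (int (card ?\<B>) * (k * (k - 1))) * (E i - E (i - 1))"
      by (simp add: algebra_simps)
    moreover have "E i - E (i - 1) \<noteq> 0"
    proof -
      consider "i = 1" | "i = 2" | "i = 3" using i by linarith
      then show ?thesis using e by cases (auto simp: E_def)
    qed
    ultimately show ?thesis by simp
  qed
  \<comment> \<open>Solving \<open>count\<close> by integer division yields a value in which
    \<open>p\<close> and \<open>q\<close> no longer occur.\<close>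
  have "card {C \<in> ?\<B>. p \<in> C \<and> q \<in> C} = nat (int (card ?\<B>) * (k * (k - 1)) div (v * (v - 1)))"
    if "p \<in> ?P" "q \<in> ?P" "p \<noteq> q" for p q
  proof -
    have "v * (v - 1) \<noteq> 0" using v by simp
    then show ?thesis unfolding count[OF that, symmetric] by (simp del: mult_eq_0_iff)
  qed
  then have "\<exists>l. \<forall>p\<in>?P. \<forall>q\<in>?P. p \<noteq> q \<longrightarrow> card {C \<in> ?\<B>. p \<in> C \<and> q \<in> C} = l" by blast
  then have "is_2_design (?P, ?\<B>)"
    unfolding is_2_design_def Let_def fst_conv snd_conv
  proof (intro conjI)
    show "?\<B> \<noteq> {}" using base_mem_orbit_blocks by blast
    show "\<exists>s. \<forall>C\<in>?\<B>. card C = s" using card_orbit_blocks by blast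
  qed (use finite_ft_points orbit_blocks_subset[OF BP] in auto)
  moreover have "flag_transitive (?P, ?\<B>) ?G"
    by (rule flag_transitive_orbit_blocks, rule ft_group_move_point[OF B]) (use x in auto)
  moreover have "point_transitive (?P, ?\<B>) ?G"
    using ft_group_transitive by (simp add: point_transitive_def)
  ultimately show ?thesis
    unfolding orbit_blocks_def[symmetric] flag_transitive_chain_imprimitive_2_design_def
    using is_automorphism_orbit_blocks by (auto simp: ft_group_def)
qed

section \<open>From conditions (1)-(3) to a box\<close>

text \<open>Once the ratios of the \<open>ft_y\<close> are the integers \<open>x1\<close>,
  \<open>x2\<close>, \<open>x3\<close>, the rational bounds become strict integer bounds, and
  \<open>x1 \<le> e1\<close> and its analogues make the box fit into the point set.\<close>

lemma ft_base_block_eq_box: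
  assumes "x1 \<le> e1" "x2 \<le> e2" "x3 \<le> e3"
    and "0 < x1" "0 < x2"
    and "ft_y e1 e2 e3 k 1 = of_int x1" "ft_y e1 e2 e3 k 2 = of_int (x1 * x2)" "k = x1 * x2 * x3"
  shows "ft_base_block e1 e2 e3 k = {0..<x1} \<times> {0..<x2} \<times> {0..<x3}"
proof -
  let ?y = "ft_y e1 e2 e3 k"
  have y: "?y 0 = 1" "?y 3 = of_int (x1 * x2 * x3)" using assms(8) by (simp_all add: ft_y_def)
  have ratios: "?y 1 / ?y 0 = of_int x1" "?y 2 / ?y 1 = of_int x2" "?y 3 / ?y 2 = of_int x3"
    using assms unfolding y assms(6,7) by simp_all
  have le: "(of_int s :: rat) \<le> of_int t - 1 \<longleftrightarrow> s < t" for s t :: int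
    by (metis of_int_1 of_int_diff of_int_le_iff zle_diff1_eq)
  have I: "{1..3} = {1, 2, 3::nat}" by auto
  have "p \<in> ft_base_block e1 e2 e3 k \<longleftrightarrow> p \<in> {0..<x1} \<times> {0..<x2} \<times> {0..<x3}" for p
  proof -
    obtain a b c where [simp]: "p = (a, b, c)" by (cases p)
    have "p \<in> ft_base_block e1 e2 e3 k \<longleftrightarrow> p \<in> ft_points e1 e2 e3 \<and>
      (0 \<le> a \<and> (of_int a :: rat) \<le> ?y 1 / ?y 0 - 1) \<and>
      (0 \<le> b \<and> (of_int b :: rat) \<le> ?y 2 / ?y 1 - 1) \<and>
      (0 \<le> c \<and> (of_int c :: rat) \<le> ?y 3 / ?y 2 - 1)"
      unfolding ft_base_block_def I by simp
    also have "\<dots> \<longleftrightarrow> p \<in> {0..<x1} \<times> {0..<x2} \<times> {0..<x3}"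
      unfolding ratios le using assms(1-3) by (auto simp: ft_points_def)
    finally show ?thesis .
  qed
  then show ?thesis by blast
qed

text \<open>Condition (1) says that \<open>(k - 1) / (v - 1)\<close> equals \<open>m / d\<close> for
  an integer \<open>m\<close>, and the bounds on \<open>k\<close> become \<open>0 < m < d\<close>.
  Since \<open>d\<close> divides both \<open>e1 - 1\<close> and \<open>e1 * e2 - 1\<close>, the
  numbers \<open>ft_y\<close> at 1 and 2 are integers, and (2), (3) reduce to their divisibility
  parts.\<close>

lemma ft_parametrisation:
  assumes e: "2 \<le> e1" "2 \<le> e2" "2 \<le> e3" and k: "1 < k" "k < e1 * e2 * e3"
    and c1: "ft_cond1 e1 e2 e3 k"
  obtains d m a b c where "e1 = 1 + d * a" "e2 = 1 + d * b" "e3 = 1 + d * c"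
    "0 < a" "0 < b" "0 < c" "gcd a (gcd b c) = 1" "0 < m" "m < d"
    "k = 1 + m * (a + b + d * a * b + c * (1 + d * a) * (1 + d * b))"
    "ft_y e1 e2 e3 k 1 = of_int (1 + m * a)"
    "ft_y e1 e2 e3 k 2 = of_int (1 + m * (a + b + d * a * b))"
    "ft_cond2 e1 e2 e3 k \<longleftrightarrow> 1 + m * a dvd b * (1 + d * a)"
    "ft_cond3 e1 e2 e3 k \<longleftrightarrow> 1 + m * (a + b + d * a * b) dvd c * (1 + d * a) * (1 + d * b)"
proof -
  define d where "d = ft_gcd e1 e2 e3"
  have d0: "0 < d" using e by (simp add: d_def ft_gcd_def gcd_pos_int)
  obtain a b c where abc: "e1 - 1 = d * a" "e2 - 1 = d * b" "e3 - 1 = d * c"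
    unfolding d_def ft_gcd_def by (meson dvdE dvd_trans gcd_dvd1 gcd_dvd2)
  have e_eq: "e1 = 1 + d * a" "e2 = 1 + d * b" "e3 = 1 + d * c" using abc by auto
  have pos: "0 < a" "0 < b" "0 < c" using abc e d0 by (smt (verit) zero_less_mult_pos)+
  have "ft_gcd e1 e2 e3 = d * gcd a (gcd b c)"
    using d0 unfolding ft_gcd_def abc by (simp add: gcd_mult_left)
  then have "d = d * gcd a (gcd b c)" unfolding d_def[symmetric] .
  then have g: "gcd a (gcd b c) = 1" using d0 by simp
  \<comment> \<open>This is \<open>(v - 1) / d\<close> with \<open>v = e1 * e2 * e3\<close>.\<close>
  define w where "w = a + b + d * a * b + c * (1 + d * a) * (1 + d * b)"
  have v: "e1 * e2 * e3 - 1 = d * w" unfolding e_eq w_def by (simp add: algebra_simps)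
  have w0: "0 < w" unfolding w_def using pos d0 by (simp add: add_pos_pos)
  obtain m where "(k - 1) * d = (d * w) * m"
    using c1 unfolding ft_cond1_def v d_def[symmetric] by (elim dvdE)
  then have "d * (k - 1) = d * (w * m)" by (simp only: ac_simps)
  then have km: "k - 1 = w * m" using d0 by (simp only: mult_cancel_left) auto
  have m0: "0 < m" using km k(1) w0 by (smt (verit) zero_less_mult_pos)
  have "w * m < w * d" using km k(2) v by (simp add: algebra_simps)
  then have md: "m < d" using w0 by simp
  have y1: "ft_y e1 e2 e3 k 1 = of_int (1 + m * a)"
    using w0 d0 by (simp add: ft_y_def v km abc)
  have ee: "e1 * e2 - 1 = d * (a + b + d * a * b)" unfolding e_eq by (simp add: algebra_simps)
  have y2: "ft_y e1 e2 e3 k 2 = of_int (1 + m * (a + b + d * a * b))"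
    using w0 d0 by (simp add: ft_y_def v km ee)
  have "((e2 - 1) * e1) div d = b * (1 + d * a)"
    unfolding abc using d0 by (simp add: e_eq(1))
  then have c2: "ft_cond2 e1 e2 e3 k \<longleftrightarrow> 1 + m * a dvd b * (1 + d * a)"
    unfolding ft_cond2_def d_def[symmetric] y1 of_int_eq_iff by auto
  have "((e3 - 1) * e1 * e2) div d = c * (1 + d * a) * (1 + d * b)"
    unfolding abc using d0 by (simp add: e_eq(1,2) mult.assoc)
  then have c3: "ft_cond3 e1 e2 e3 k \<longleftrightarrow> 1 + m * (a + b + d * a * b) dvd c * (1 + d * a) * (1 + d * b)"
    unfolding ft_cond3_def d_def[symmetric] y2 of_int_eq_iff by auto
  have k_eq: "k = 1 + m * (a + b + d * a * b + c * (1 + d * a) * (1 + d * b))"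
    using km unfolding w_def by (simp add: algebra_simps)
  show thesis by (rule that[OF e_eq pos g m0 md k_eq y1 y2 c2 c3])
qed

text \<open>The conditions provide integer sides \<open>x1\<close>, \<open>x2\<close>,
  \<open>x3\<close> of the base block; what remains is that they lie between 1 and the
  \<open>e\<close>'s and satisfy the proportions required by \<open>box_orbit_2_design\<close>,
  which are polynomial identities in the parameters.\<close>

lemma ft_design_flag_transitive:
  assumes e: "2 \<le> e1" "2 \<le> e2" "2 \<le> e3" and k: "1 < k" "k < e1 * e2 * e3"
    and c: "ft_cond1 e1 e2 e3 k" "ft_cond2 e1 e2 e3 k" "ft_cond3 e1 e2 e3 k"
  shows "flag_transitive_chain_imprimitive_2_design 3
    (ft_design e1 e2 e3 k) (ft_group e1 e2 e3) (ft_chain e1 e2 e3)"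
proof -
  obtain d m a b c where e_eq: "e1 = 1 + d * a" "e2 = 1 + d * b" "e3 = 1 + d * c"
    and pos: "0 < a" "0 < b" "0 < c" and m: "0 < m" "m < d"
    and k_eq: "k = 1 + m * (a + b + d * a * b + c * (1 + d * a) * (1 + d * b))"
    and y1: "ft_y e1 e2 e3 k 1 = of_int (1 + m * a)"
    and y2: "ft_y e1 e2 e3 k 2 = of_int (1 + m * (a + b + d * a * b))"
    and dvd: "1 + m * a dvd b * (1 + d * a)"
      "1 + m * (a + b + d * a * b) dvd c * (1 + d * a) * (1 + d * b)"
    using ft_parametrisation[OF e k c(1)] c(2,3) by metis
  define x1 z where "x1 = 1 + m * a" and "z = 1 + m * (a + b + d * a * b)"
  obtain t where t: "b * (1 + d * a) = x1 * t" using dvd(1) unfolding x1_def by (elim dvdE)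
  obtain u where u: "c * (1 + d * a) * (1 + d * b) = z * u" using dvd(2) unfolding z_def by (elim dvdE)
  define x2 x3 where "x2 = 1 + m * t" and "x3 = 1 + m * u"
  \<comment> \<open>\<open>y\<^sub>i - y\<^sub>i\<^sub>-\<^sub>1\<close> is \<open>m\<close> times the number that \<open>y\<^sub>i\<^sub>-\<^sub>1\<close> divides by assumption.\<close>
  have "x1 * x2 = x1 + m * (b * (1 + d * a))" unfolding t x2_def by (simp add: algebra_simps)
  then have z: "z = x1 * x2" unfolding x1_def z_def by (simp add: algebra_simps)
  have "z * x3 = z + m * (c * (1 + d * a) * (1 + d * b))" unfolding u x3_def by (simp add: algebra_simps)
  then have k_prod: "k = x1 * x2 * x3" unfolding z[symmetric] unfolding z_def k_eq by (simp add: algebra_simps)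
  have d0: "0 < d" using m by simp
  have x1_pos: "0 < x1" unfolding x1_def using m pos by (simp add: add_pos_pos)
  have z_pos: "0 < z" unfolding z_def using m pos d0 by (simp add: add_pos_pos)
  have "0 < x1 * t" unfolding t[symmetric] using pos d0 by (simp add: add_pos_pos)
  then have x2_pos: "1 \<le> x2" unfolding x2_def using x1_pos m by (simp add: zero_less_mult_iff)
  have "0 < z * u" unfolding u[symmetric] using pos d0 by (simp add: add_pos_pos)
  then have x3_pos: "1 \<le> x3" unfolding x3_def using z_pos m by (simp add: zero_less_mult_iff)
  have x1_le: "x1 \<le> e1" unfolding x1_def e_eq using m pos by (simp add: mult_right_mono)
  \<comment> \<open>The bound on each further side comes from \<open>m < d\<close>: the defect
    \<open>e2 - x2\<close> times \<open>x1\<close> collapses to \<open>b * (d - m)\<close>. The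
    third side is treated alike, with \<open>z\<close> and \<open>c\<close>.\<close>
  have "x1 * (e2 - x2) = b * (d - m)"
    unfolding right_diff_distrib z[symmetric] unfolding x1_def z_def e_eq by (simp add: algebra_simps)
  then have "0 \<le> x1 * (e2 - x2)" using m pos by simp
  then have x2_le: "x2 \<le> e2" using x1_pos by (simp add: zero_le_mult_iff)
  have "z * (e3 - x3) = c * (d - m)"
    unfolding right_diff_distrib z k_prod[symmetric] unfolding z[symmetric] unfolding z_def k_eq e_eq
    by (simp add: algebra_simps)
  then have "0 \<le> z * (e3 - x3)" using m pos by simp
  then have x3_le: "x3 \<le> e3" using z_pos by (simp add: zero_le_mult_iff)
  have "ft_base_block e1 e2 e3 k = {0..<x1} \<times> {0..<x2} \<times> {0..<x3}"
    using ft_base_block_eq_box x1_le x2_le x3_le x1_pos x2_pos y1 y2 k_prod z unfolding x1_def z_def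
    by simp
  moreover have "(e1 * e2 * e3 - 1) * (x1 - 1) = (x1 * x2 * x3 - 1) * (e1 - 1)"
    unfolding k_prod[symmetric] unfolding k_eq e_eq x1_def by (simp add: algebra_simps)
  moreover have "(e1 * e2 * e3 - 1) * (x1 * x2 - 1) = (x1 * x2 * x3 - 1) * (e1 * e2 - 1)"
    unfolding k_prod[symmetric] unfolding z[symmetric] unfolding k_eq e_eq z_def by (simp add: algebra_simps)
  ultimately show ?thesis
    unfolding ft_design_def
    using box_orbit_2_design e x1_pos x1_le x2_pos x2_le x3_pos x3_le by simp
qed

section \<open>The finite search\<close>

text \<open>A list can be traversed by evaluation. Its order is that of the set in the final
  statement, so unfolding \<open>list.set\<close> yields that set literally.\<close>

definition solutions :: "(int \<times> int \<times> int \<times> int) list" where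
  "solutions = [
      (3,5,17,128), (3,5,33,248), (3,5,49,368), (3,9,29,392), (3,13,41,800),
      (4,4,10,54), (4,4,19,102), (4,4,28,150), (4,4,37,198), (4,4,46,246),
      (4,7,16,150), (4,7,31,290), (4,7,46,430), (4,10,22,294), (4,10,43,574),
      (4,13,28,486), (4,16,34,726), (4,19,40,1014), (4,22,46,1350), (5,7,37,648),
      (5,9,17,192), (5,9,33,372), (5,9,49,552), (6,6,11,80), (6,6,21,152),
      (6,6,26,375), (6,6,31,224), (6,6,41,296), (6,11,36,476), (6,11,46,1215),
      (6,16,26,500), (6,26,41,1280), (7,10,37,864), (7,25,37,1080), (8,8,36,330),
      (8,8,50,1372), (8,15,22,378), (8,15,43,738), (8,36,50,2058), (9,5,17,192),
      (9,5,33,372), (9,5,49,552), (9,9,29,588), (9,13,41,1200), (10,7,37,864),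
      (10,10,28,312), (10,28,37,1152), (11,16,46,1620), (12,12,34,891), (15,8,22,378),
      (15,8,43,738), (15,8,50,1715), (16,6,26,500), (16,11,46,1620), (25,7,37,1080),
      (28,10,37,1152), (36,8,50,2058)]"

text \<open>The bounds \<open>49 div d\<close> express that each \<open>e\<close> is at most 50, and
  \<open>d\<close> starts at 2 because \<open>0 < m < d\<close>. The divisibility without
  \<open>c\<close> is tested before the loop over \<open>c\<close>, which prunes most of the
  search.\<close>

lemma solutions_complete_computation:
  "list_all (\<lambda>d. list_all (\<lambda>m. list_all (\<lambda>a. list_all (\<lambda>b.
     \<not> 1 + m * a dvd b * (1 + d * a) \<or>
     list_all (\<lambda>c.
        \<not> 1 + m * (a + b + d * a * b) dvd c * (1 + d * a) * (1 + d * b) \<or>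
        gcd a (gcd b c) \<noteq> 1 \<or>
        (1 + d * a, 1 + d * b, 1 + d * c,
         1 + m * (a + b + d * a * b + c * (1 + d * a) * (1 + d * b))) \<in> set solutions)
     [1..49 div d]) [1..49 div d]) [1..49 div d]) [1..d - 1]) [2..49]"
  by code_simp

text \<open>The conditions in pure integer form: the tests of divisibility by \<open>v - 1\<close>
  make the quotients in \<open>y1\<close> and \<open>y2\<close> exact, so that these are the values
  of the rational \<open>ft_y\<close>.\<close>

lemma solutions_sound_computation:
  "list_all (\<lambda>(e1, e2, e3, k).
     let v = e1 * e2 * e3; d = ft_gcd e1 e2 e3;
         y1 = 1 + (k - 1) * (e1 - 1) div (v - 1);
         y2 = 1 + (k - 1) * (e1 * e2 - 1) div (v - 1)
     in v - 1 dvd (k - 1) * d \<and>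
        v - 1 dvd (k - 1) * (e1 - 1) \<and> y1 dvd ((e2 - 1) * e1) div d \<and>
        v - 1 dvd (k - 1) * (e1 * e2 - 1) \<and> y2 dvd ((e3 - 1) * e1 * e2) div d) solutions"
  by code_simp

lemma ft_conds_imp_solution:
  assumes e: "2 \<le> e1" "e1 \<le> 50" "2 \<le> e2" "e2 \<le> 50" "2 \<le> e3" "e3 \<le> 50"
    and k: "1 < k" "k < e1 * e2 * e3"
    and c: "ft_cond1 e1 e2 e3 k" "ft_cond2 e1 e2 e3 k" "ft_cond3 e1 e2 e3 k"
  shows "(e1, e2, e3, k) \<in> set solutions"
proof -
  obtain d m a b c where e_eq: "e1 = 1 + d * a" "e2 = 1 + d * b" "e3 = 1 + d * c"
    and pos: "0 < a" "0 < b" "0 < c" and m: "0 < m" "m < d" and g: "gcd a (gcd b c) = 1"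
    and k_eq: "k = 1 + m * (a + b + d * a * b + c * (1 + d * a) * (1 + d * b))"
    and dvd: "1 + m * a dvd b * (1 + d * a)"
      "1 + m * (a + b + d * a * b) dvd c * (1 + d * a) * (1 + d * b)"
    using ft_parametrisation[OF e(1,3,5) k c(1)] c(2,3) by metis
  have d0: "0 < d" using m by simp
  have le: "x \<in> {1..49 div d}" if "0 < x" "d * x \<le> 49" for x
    using that d0 zdiv_mono1[OF that(2) d0] by simp
  \<comment> \<open>Since \<open>a\<close> is at least 1, \<open>d\<close> is at most
    \<open>e1 - 1\<close>, which puts it in the range of the search.\<close>
  have "d * 1 \<le> d * a" by (rule mult_left_mono) (use pos d0 in auto)
  then have "d \<le> 49" using e(2) e_eq(1) by linarith
  then have d: "d \<in> {2..49}" using m by simp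
  have m': "m \<in> {1..d - 1}" using m by auto
  have abc: "a \<in> {1..49 div d}" "b \<in> {1..49 div d}" "c \<in> {1..49 div d}"
    using e e_eq pos le by auto
  note solutions_complete_computation[unfolded list_all_iff set_upto]
  note bspec[OF bspec[OF bspec[OF bspec[OF this d] m'] abc(1)] abc(2)]
  then have "\<forall>c\<in>{1..49 div d}.
        \<not> 1 + m * (a + b + d * a * b) dvd c * (1 + d * a) * (1 + d * b) \<or>
        gcd a (gcd b c) \<noteq> 1 \<or>
        (1 + d * a, 1 + d * b, 1 + d * c,
         1 + m * (a + b + d * a * b + c * (1 + d * a) * (1 + d * b))) \<in> set solutions"
    using dvd(1) by (elim disjE notE)
  from bspec[OF this abc(3)] show ?thesis
    unfolding k_eq e_eq using g dvd(2) by (elim disjE) (simp_all only: not_True_eq_False)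
qed

text \<open>Transfers the integer check to the rational \<open>ft_y\<close>: as \<open>v - 1\<close>
  is nonzero, the exact integer quotients \<open>q1\<close> and \<open>q2\<close> agree with the
  rational ones.\<close>

lemma solution_imp_ft_conds:
  assumes "(e1, e2, e3, k) \<in> set solutions" and e: "2 \<le> e1" "2 \<le> e2" "2 \<le> e3"
  shows "ft_cond1 e1 e2 e3 k \<and> ft_cond2 e1 e2 e3 k \<and> ft_cond3 e1 e2 e3 k"
proof -
  let ?d = "ft_gcd e1 e2 e3" and ?v = "e1 * e2 * e3"
  define q1 q2 where "q1 = (k - 1) * (e1 - 1) div (?v - 1)"
    and "q2 = (k - 1) * (e1 * e2 - 1) div (?v - 1)"
  have "(\<lambda>(e1, e2, e3, k).
     let v = e1 * e2 * e3; d = ft_gcd e1 e2 e3;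
         y1 = 1 + (k - 1) * (e1 - 1) div (v - 1);
         y2 = 1 + (k - 1) * (e1 * e2 - 1) div (v - 1)
     in v - 1 dvd (k - 1) * d \<and>
        v - 1 dvd (k - 1) * (e1 - 1) \<and> y1 dvd ((e2 - 1) * e1) div d \<and>
        v - 1 dvd (k - 1) * (e1 * e2 - 1) \<and> y2 dvd ((e3 - 1) * e1 * e2) div d) (e1, e2, e3, k)"
    using solutions_sound_computation assms(1) unfolding list_all_iff by (rule bspec)
  then have *: "?v - 1 dvd (k - 1) * ?d"
    "(k - 1) * (e1 - 1) = (?v - 1) * q1" "1 + q1 dvd ((e2 - 1) * e1) div ?d"
    "(k - 1) * (e1 * e2 - 1) = (?v - 1) * q2" "1 + q2 dvd ((e3 - 1) * e1 * e2) div ?d"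
    unfolding q1_def q2_def by (simp_all add: Let_def)
  have "2 * 2 \<le> e1 * e2" using e by (intro mult_mono) auto
  then have "2 * 2 * 2 \<le> e1 * e2 * e3" using e by (intro mult_mono) auto
  then have v: "?v - 1 \<noteq> 0" by simp
  have quotient: "(of_int (k - 1) :: rat) / of_int (?v - 1) * of_int s = of_int q"
    if "(k - 1) * s = (?v - 1) * q" for s q
  proof -
    have "(of_int (k - 1) :: rat) / of_int (?v - 1) * of_int s = of_int ((k - 1) * s) / of_int (?v - 1)"
      by simp
    also have "\<dots> = of_int q" unfolding that of_int_mult using v
      by (metis nonzero_mult_div_cancel_left of_int_eq_0_iff)
    finally show ?thesis .
  qed
  have "ft_y e1 e2 e3 k 1 = of_int (1 + q1)" "ft_y e1 e2 e3 k 2 = of_int (1 + q2)"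
    unfolding ft_y_def by (simp_all only: quotient[OF *(2)] quotient[OF *(4)]) simp_all
  then show ?thesis using *(1,3,5) unfolding ft_cond1_def ft_cond2_def ft_cond3_def by blast
qed

theorem theorem6p3:
  fixes e1 e2 e3 k :: int
  assumes "2 \<le> e1" and "e1 \<le> 50"
    and "2 \<le> e2" and "e2 \<le> 50"
    and "2 \<le> e3" and "e3 \<le> 50"
    and "1 < k" and "k < e1 * e2 * e3"
  shows "ft_cond1 e1 e2 e3 k \<and> ft_cond2 e1 e2 e3 k \<and> ft_cond3 e1 e2 e3 k \<and>
      flag_transitive_chain_imprimitive_2_design 3
        (ft_design e1 e2 e3 k) (ft_group e1 e2 e3) (ft_chain e1 e2 e3) \<longleftrightarrow>
    (e1, e2, e3, k) \<in> {
      (3,5,17,128), (3,5,33,248), (3,5,49,368), (3,9,29,392), (3,13,41,800),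
      (4,4,10,54), (4,4,19,102), (4,4,28,150), (4,4,37,198), (4,4,46,246),
      (4,7,16,150), (4,7,31,290), (4,7,46,430), (4,10,22,294), (4,10,43,574),
      (4,13,28,486), (4,16,34,726), (4,19,40,1014), (4,22,46,1350), (5,7,37,648),
      (5,9,17,192), (5,9,33,372), (5,9,49,552), (6,6,11,80), (6,6,21,152),
      (6,6,26,375), (6,6,31,224), (6,6,41,296), (6,11,36,476), (6,11,46,1215),
      (6,16,26,500), (6,26,41,1280), (7,10,37,864), (7,25,37,1080), (8,8,36,330),
      (8,8,50,1372), (8,15,22,378), (8,15,43,738), (8,36,50,2058), (9,5,17,192),
      (9,5,33,372), (9,5,49,552), (9,9,29,588), (9,13,41,1200), (10,7,37,864),
      (10,10,28,312), (10,28,37,1152), (11,16,46,1620), (12,12,34,891), (15,8,22,378),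
      (15,8,43,738), (15,8,50,1715), (16,6,26,500), (16,11,46,1620), (25,7,37,1080),
      (28,10,37,1152), (36,8,50,2058)}"
proof -
  let ?S = "(e1, e2, e3, k) \<in> set solutions"
  \<comment> \<open>From right to left, the conditions hold by the check of the list, and the design
    property is then deduced from them.\<close>
  have "ft_cond1 e1 e2 e3 k \<and> ft_cond2 e1 e2 e3 k \<and> ft_cond3 e1 e2 e3 k \<and>
      flag_transitive_chain_imprimitive_2_design 3
        (ft_design e1 e2 e3 k) (ft_group e1 e2 e3) (ft_chain e1 e2 e3) \<longleftrightarrow> ?S"
    using ft_conds_imp_solution[OF assms] solution_imp_ft_conds ft_design_flag_transitive assms by blast
  then show ?thesis unfolding solutions_def list.set .
qed

end
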